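(* Assume that the functions $C_t$ and $A_t$, $1\le t\le T$, are convex. Let $s^*=(s^*_0,\dots,s^*_T)$ denote a solution to the problem $\mathbf{P}$. Then there exists a vector $\lambda^*=(\lambda^*_1,\dots,\lambda^*_T)\in\mathbb{R}^T$ such that: (i) for all vectors $s=(s_0,\dots,s_T)$ such that $s_0=s^*_0$ and $x_t(s)\in X_t$ for all $t$ ($s$ is not otherwise constrained), $$\sum_{t=1}^T\bigl[C_t(x_t(s))+A_t(s_t)-\lambda^*_t s_t\bigr]\ \ge\ \sum_{t=1}^T\bigl[C_t(x_t(s^* ))+A_t(s^*_t)-\lambda^*_t s^*_t\bigr];$$ (ii) the pair $(s^*,\lambda^* )$ satisfies the complementary slackness conditions, for $1\le t\le T$, $$\begin{cases}\lambda^*_t=0&\text{if } 0<s^*_t<E_t,\\ \lambda^*_t\ge 0&\text{if } s^*_t=0,\\ \lambda^*_t\le 0&\text{if } s^*_t=E_t.\end{cases}$$ Conversely, suppose that there exists a pair of vectors $(s^*,\lambda^* )$, with $s^*$ having the prescribed initial component $s^*_0$, satisfying conditions (i) and (ii) and such that $s^*$ is additionally feasible for the problem $\mathbf{P}$. Then $s^*$ solves the problem $\mathbf{P}$.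
   Context: Time periods are $t=1,\dots,T$. A store has capacity $E_t>0$ in period $t$, and input and output rate limits $P_{It},P_{Ot}\ge 0$; put $X_t=\{x\in\mathbb{R}:-P_{Ot}\le x\le P_{It}\}$. $C_t$ is a real-valued function on $X_t$ and $A_t$ is a real-valued function on $\mathbb{R}$. The initial level $s^*_0$ is given and fixed. For $s=(s_0,\dots,s_T)$ put $x_t(s)=s_t-s_{t-1}$, $1\le t\le T$. Problem $\mathbf{P}$: choose $s=(s_0,\dots,s_T)$ with $s_0=s^*_0$ so as to minimise $\sum_{t=1}^T[C_t(x_t(s))+A_t(s_t)]$ subject to the capacity constraints $0\le s_t\le E_t$ and the rate constraints $x_t(s)\in X_t$, $1\le t\le T$. A vector is feasible for $\mathbf{P}$ if it satisfies these constraints and has $s_0=s^*_0$.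
   Formalization: The existence of λ* is proved under the added assumption that each C_t has a finite subgradient relative to X_t at x_t(s* ); without it the claim fails, e.g. T=1, E=1, s_0=0, P_I=0, P_O=1, C(x)=-√(-x), A=0. The assumption is also necessary for (i). *)

theory Defs
  imports "HOL-Analysis.Analysis"
begin

text \<open>A level vector \<open>(s\<^sub>0, \<dots>, s\<^sub>T)\<close> is a function on \<open>nat\<close>, and period-indexed data
  \<open>(y\<^sub>1, \<dots>, y\<^sub>T)\<close> likewise; only the arguments in \<open>{0..T}\<close>, resp. \<open>{1..T}\<close>, are ever inspected.
  The cost \<open>C t\<close> is only evaluated on \<open>rate_set P\<^sub>I P\<^sub>O t\<close>.\<close>

definition rate :: "(nat \<Rightarrow> real) \<Rightarrow> nat \<Rightarrow> real"
  where "rate s t = s t - s (t - 1)"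

definition rate_set :: "(nat \<Rightarrow> real) \<Rightarrow> (nat \<Rightarrow> real) \<Rightarrow> nat \<Rightarrow> real set"
  where "rate_set P\<^sub>I P\<^sub>O t = {- P\<^sub>O t .. P\<^sub>I t}"

definition rate_feasible ::
    "nat \<Rightarrow> (nat \<Rightarrow> real) \<Rightarrow> (nat \<Rightarrow> real) \<Rightarrow> real \<Rightarrow> (nat \<Rightarrow> real) \<Rightarrow> bool"
  where "rate_feasible T P\<^sub>I P\<^sub>O s0 s \<longleftrightarrow>
    s 0 = s0 \<and> (\<forall>t\<in>{1..T}. rate s t \<in> rate_set P\<^sub>I P\<^sub>O t)"

definition feasible ::
    "nat \<Rightarrow> (nat \<Rightarrow> real) \<Rightarrow> (nat \<Rightarrow> real) \<Rightarrow> (nat \<Rightarrow> real) \<Rightarrow> real \<Rightarrow> (nat \<Rightarrow> real) \<Rightarrow> bool"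
  where "feasible T E P\<^sub>I P\<^sub>O s0 s \<longleftrightarrow>
    rate_feasible T P\<^sub>I P\<^sub>O s0 s \<and> (\<forall>t\<in>{1..T}. 0 \<le> s t \<and> s t \<le> E t)"

definition total_cost ::
    "nat \<Rightarrow> (nat \<Rightarrow> real \<Rightarrow> real) \<Rightarrow> (nat \<Rightarrow> real \<Rightarrow> real) \<Rightarrow> (nat \<Rightarrow> real) \<Rightarrow> real"
  where "total_cost T C A s = (\<Sum>t=1..T. C t (rate s t) + A t (s t))"

definition solves_P ::
    "nat \<Rightarrow> (nat \<Rightarrow> real) \<Rightarrow> (nat \<Rightarrow> real) \<Rightarrow> (nat \<Rightarrow> real) \<Rightarrow>
     (nat \<Rightarrow> real \<Rightarrow> real) \<Rightarrow> (nat \<Rightarrow> real \<Rightarrow> real) \<Rightarrow> real \<Rightarrow> (nat \<Rightarrow> real) \<Rightarrow> bool"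
  where "solves_P T E P\<^sub>I P\<^sub>O C A s0 s \<longleftrightarrow>
    is_arg_min (total_cost T C A) (feasible T E P\<^sub>I P\<^sub>O s0) s"

definition lagrangian ::
    "nat \<Rightarrow> (nat \<Rightarrow> real \<Rightarrow> real) \<Rightarrow> (nat \<Rightarrow> real \<Rightarrow> real) \<Rightarrow> (nat \<Rightarrow> real) \<Rightarrow> (nat \<Rightarrow> real) \<Rightarrow> real"
  where "lagrangian T C A l s = (\<Sum>t=1..T. C t (rate s t) + A t (s t) - l t * s t)"

definition minimises_lagrangian ::
    "nat \<Rightarrow> (nat \<Rightarrow> real) \<Rightarrow> (nat \<Rightarrow> real) \<Rightarrow>
     (nat \<Rightarrow> real \<Rightarrow> real) \<Rightarrow> (nat \<Rightarrow> real \<Rightarrow> real) \<Rightarrow> real \<Rightarrow>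
     (nat \<Rightarrow> real) \<Rightarrow> (nat \<Rightarrow> real) \<Rightarrow> bool"
  where "minimises_lagrangian T P\<^sub>I P\<^sub>O C A s0 s1 l \<longleftrightarrow>
    (\<forall>s. rate_feasible T P\<^sub>I P\<^sub>O s0 s \<longrightarrow> lagrangian T C A l s \<ge> lagrangian T C A l s1)"

definition compl_slack ::
    "nat \<Rightarrow> (nat \<Rightarrow> real) \<Rightarrow> (nat \<Rightarrow> real) \<Rightarrow> (nat \<Rightarrow> real) \<Rightarrow> bool"
  where "compl_slack T E s l \<longleftrightarrow>
    (\<forall>t\<in>{1..T}. (0 < s t \<and> s t < E t \<longrightarrow> l t = 0) \<and>
                (s t = 0 \<longrightarrow> l t \<ge> 0) \<and>
                (s t = E t \<longrightarrow> l t \<le> 0))"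

text \<open>Some line through \<open>(x, f x)\<close> of finite slope lies below the graph of \<open>f\<close> on \<open>X\<close>. For \<open>f\<close>
  convex on an interval \<open>X\<close> this holds at every interior point of \<open>X\<close>; it can fail only at an
  endpoint, where \<open>f\<close> may jump upwards or have infinite slope (e.g. \<open>- sqrt\<close> at \<open>0\<close>).

  If it fails at an optimal rate, there are no multipliers: with one period, \<open>s\<^sub>0 = 2\<close>, capacity
  \<open>1\<close>, both rate limits \<open>1\<close>, \<open>C x = - sqrt (1 + x)\<close> and \<open>A = 0\<close>, the only feasible rate is
  \<open>-1\<close>, and minimality of the Lagrangian would require \<open>- sqrt u \<ge> l * u\<close> for all \<open>u \<in> {0..2}\<close>.\<close>

definition subdifferentiable_on :: "real set \<Rightarrow> (real \<Rightarrow> real) \<Rightarrow> real \<Rightarrow> bool"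
  where "subdifferentiable_on X f x \<longleftrightarrow> (\<exists>g. \<forall>y\<in>X. f y \<ge> f x + g * (y - x))"

end

theory Submission
  imports Defs
begin

text \<open>The converse direction is weak duality: complementary slackness says that
  \<open>l t * (y - s t) \<ge> 0\<close> for every admissible level \<open>y\<close>, so passing from the Lagrangian to the cost
  can only favour \<open>s\<close> among feasible vectors.

  For the existence of multipliers, suppose that there are subgradients \<open>g t\<close> of \<open>C t\<close> at the
  optimal rate and \<open>k t\<close> of \<open>A t\<close> restricted to \<open>[0, E t]\<close> at the optimal level with
  \<open>k t = g (t + 1) - g t\<close> and \<open>g (T + 1) = 0\<close>. Here \<open>- g (t + 1)\<close> is the marginal future cost of a
  unit of stored level. The normal cone of the capacity interval accounts for the difference
  between \<open>k t\<close> and a subgradient of \<open>A t\<close> on the whole line, and this difference is the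
  multiplier \<open>l t\<close>. Adding up the subgradient inequalities and summing by parts, the linear terms
  cancel, and what remains is the minimality of the Lagrangian.

  The constraints need not have an interior point, so a general Slater-type duality theorem does
  not give this chain. Dynamic programming reduces the question to one dimension, where the
  subdifferential sum rule holds as soon as each summand has some subgradient, even if the domains
  share a single point (\<open>supports_sum_split\<close>). The subdifferentials of the cost-to-go are nonempty
  by backward induction, as infimal convolution and addition preserve this; going forward again,
  the negative of a subgradient of the cost-to-go at time \<open>t\<close> is a subgradient of the next rate cost,
  and the subgradient itself splits into one of the next level cost and one of the cost-to-go at
  time \<open>t + 1\<close> (\<open>supporting_chain\<close>).\<close>

section \<open>Subgradients as slopes of supporting lines\<close>

text \<open>Subgradients are stated for subsets of the plane, thought of as epigraphs, because the
  cost-to-go is an infimum that need not be attained: a set closed upwards records it without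
  mentioning the infimum.\<close>

definition supports :: "(real \<times> real) set \<Rightarrow> real \<times> real \<Rightarrow> real \<Rightarrow> bool"
  where "supports S p m \<longleftrightarrow> (\<forall>(y, c)\<in>S. c \<ge> snd p + m * (y - fst p))"

lemma supportsD: "supports S (x, a) m \<Longrightarrow> (y, c) \<in> S \<Longrightarrow> a + m * (y - x) \<le> c"
  by (auto simp: supports_def)

lemma supports_epigraph_iff:
  "supports (epigraph X f) (x, f x) m \<longleftrightarrow> (\<forall>y\<in>X. f y \<ge> f x + m * (y - x))"
  by (force simp: supports_def epigraph_def)

lemma closed_supports: "closed {m. supports S p m}"
proof -
  have "{m. supports S p m} = (\<Inter>(y, c)\<in>S. {m. snd p + m * (y - fst p) \<le> c})"
    by (auto simp: supports_def)
  moreover have "closed {m. snd p + m * (y - fst p) \<le> c}" for y c :: real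
    by (intro closed_Collect_le continuous_intros)
  ultimately show ?thesis
    by (auto intro!: closed_INT)
qed

text \<open>Every slope between a subgradient of one summand and the complement of a subgradient of the
  other is good for at least one of the summands. Suppose that \<open>r\<close> fails for both. The known line of
  each summand rules out a failure on one side of \<open>x\<close>, and this is the same side for both, so both
  failures occur on the other side. By convexity they persist all the way to \<open>x\<close>, hence occur at a
  common point, where they add up to a violation of the inequality for the sum.\<close>

lemma slope_split_covers:
  assumes V: "convex V" "(x, a) \<in> V" "supports V (x, a) p\<^sub>0"
    and U: "convex U" "(x, b) \<in> U" "supports U (x, b) (m - q\<^sub>0)"
    and sum: "\<And>y c d. (y, c) \<in> V \<Longrightarrow> (y, d) \<in> U \<Longrightarrow> a + b + m * (y - x) \<le> c + d"
    and r: "r \<in> closed_segment p\<^sub>0 q\<^sub>0"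
  shows "supports V (x, a) r \<or> supports U (x, b) (m - r)"
proof (rule ccontr)
  assume "\<not> ?thesis"
  then obtain y c z d where yc: "(y, c) \<in> V" "c < a + r * (y - x)"
    and zd: "(z, d) \<in> U" "d < b + (m - r) * (z - x)"
    by (force simp: supports_def not_le)
  have "0 < (r - p\<^sub>0) * (y - x)"
    using supportsD[OF V(3) yc(1)] yc(2) by (simp add: algebra_simps)
  moreover have "0 < (q\<^sub>0 - r) * (z - x)"
    using supportsD[OF U(3) zd(1)] zd(2) by (simp add: algebra_simps)
  moreover have "p\<^sub>0 \<le> r \<and> r \<le> q\<^sub>0 \<or> q\<^sub>0 \<le> r \<and> r \<le> p\<^sub>0"
    using r by (auto simp: closed_segment_eq_real_ivl split: if_splits)
  ultimately have same_side: "x < y \<and> x < z \<or> y < x \<and> z < x"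
    by (auto simp: zero_less_mult_iff)
  \<comment> \<open>Contraction factors towards \<open>x\<close> that carry \<open>y\<close> and \<open>z\<close> to one point \<open>w\<close>.\<close>
  define \<alpha> where "\<alpha> = (z - x) / ((y - x) + (z - x))"
  define \<beta> where "\<beta> = (y - x) / ((y - x) + (z - x))"
  have pos: "0 < \<alpha>" "0 < \<beta>" and one: "\<alpha> + \<beta> = 1"
    using same_side unfolding \<alpha>_def \<beta>_def
    by (auto simp: zero_less_divide_iff simp flip: add_divide_distrib)
  have meet: "\<alpha> * (y - x) = \<beta> * (z - x)"
    by (simp add: \<alpha>_def \<beta>_def)
  define w where "w = x + \<alpha> * (y - x)"
  have "\<beta> *\<^sub>R (x, a) + \<alpha> *\<^sub>R (y, c) \<in> V"
    using V yc pos one by (intro convexD) auto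
  also have "\<beta> *\<^sub>R (x, a) + \<alpha> *\<^sub>R (y, c) = (w, a + \<alpha> * (c - a))"
    using one unfolding w_def by (auto simp: algebra_simps simp flip: distrib_right)
  finally have wV: "(w, a + \<alpha> * (c - a)) \<in> V" .
  have "\<alpha> *\<^sub>R (x, b) + \<beta> *\<^sub>R (z, d) \<in> U"
    using U zd pos one by (intro convexD) auto
  also have "\<alpha> *\<^sub>R (x, b) + \<beta> *\<^sub>R (z, d) = (w, b + \<beta> * (d - b))"
    using one unfolding w_def meet by (auto simp: algebra_simps simp flip: distrib_right)
  finally have wU: "(w, b + \<beta> * (d - b)) \<in> U" .
  have "\<alpha> * (c - a) < \<alpha> * (r * (y - x))" "\<beta> * (d - b) < \<beta> * ((m - r) * (z - x))"
    using yc zd pos by (auto intro!: mult_strict_left_mono)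
  moreover have "\<alpha> * (r * (y - x)) = r * (w - x)"
    by (simp add: w_def)
  moreover have "\<beta> * ((m - r) * (z - x)) = (m - r) * (w - x)"
    using meet by (simp add: w_def)
  ultimately show False
    using sum[OF wV wU] by (simp add: algebra_simps)
qed

text \<open>The one-dimensional sum rule: the slopes good for either summand form two closed sets that
  cover a segment and each contain one of its endpoints, so by connectedness they meet.\<close>

lemma supports_sum_split:
  assumes V: "convex V" "(x, a) \<in> V" "supports V (x, a) p\<^sub>0"
    and U: "convex U" "(x, b) \<in> U" "supports U (x, b) q\<^sub>0"
    and sum: "\<And>y c d. (y, c) \<in> V \<Longrightarrow> (y, d) \<in> U \<Longrightarrow> a + b + m * (y - x) \<le> c + d"
  obtains p where "supports V (x, a) p" "supports U (x, b) (m - p)"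
proof -
  let ?P = "{r. supports V (x, a) r}"
  let ?Q = "{r. supports U (x, b) (m - r)}"
  let ?S = "closed_segment p\<^sub>0 (m - q\<^sub>0)"
  have "closed ((\<lambda>r. m - r) -` {q. supports U (x, b) q})"
    by (intro closed_vimage closed_supports continuous_intros)
  then have "closed ?Q"
    by (simp add: vimage_def)
  moreover have "?S \<subseteq> ?P \<union> ?Q"
    using slope_split_covers[OF V U(1,2) _ sum, of "m - q\<^sub>0"] U(3) by auto
  moreover have "p\<^sub>0 \<in> ?P \<inter> ?S" "m - q\<^sub>0 \<in> ?Q \<inter> ?S"
    using V U by auto
  ultimately have "?P \<inter> ?Q \<inter> ?S \<noteq> {}"
    using connected_closedD[OF connected_segment(1), of ?P ?Q p\<^sub>0 "m - q\<^sub>0"] closed_supports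
    by blast
  then show ?thesis
    using that by blast
qed

section \<open>Addition and infimal convolution of epigraphs\<close>

definition epi_sum :: "(real \<times> real) set \<Rightarrow> (real \<times> real) set \<Rightarrow> (real \<times> real) set"
  where "epi_sum U V = {(z, b + d) | z b d. (z, b) \<in> U \<and> (z, d) \<in> V}"

text \<open>One Bellman step: for epigraphs of \<open>f\<close> and \<open>h\<close> this is, up to attainment of the infimum, the
  epigraph of \<open>y \<mapsto> inf\<^sub>z f (z - y) + h z\<close>.\<close>

definition epi_step :: "(real \<times> real) set \<Rightarrow> (real \<times> real) set \<Rightarrow> (real \<times> real) set"
  where "epi_step U Q = {(y, a + d) | y z a d. (z - y, a) \<in> U \<and> (z, d) \<in> Q}"

lemma epi_sumI: "(z, b) \<in> U \<Longrightarrow> (z, d) \<in> V \<Longrightarrow> (z, b + d) \<in> epi_sum U V"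
  by (auto simp: epi_sum_def)

lemma epi_stepI: "(z - y, a) \<in> U \<Longrightarrow> (z, d) \<in> Q \<Longrightarrow> (y, a + d) \<in> epi_step U Q"
  by (auto simp: epi_step_def)

lemma convex_epi_sum:
  assumes "convex U" "convex V"
  shows "convex (epi_sum U V)"
proof (rule convexI)
  fix p q and u v :: real
  assume "p \<in> epi_sum U V" "q \<in> epi_sum U V" and uv: "0 \<le> u" "0 \<le> v" "u + v = 1"
  then obtain z b d z' b' d' where p: "p = (z, b + d)" "(z, b) \<in> U" "(z, d) \<in> V"
    and q: "q = (z', b' + d')" "(z', b') \<in> U" "(z', d') \<in> V"
    by (auto simp: epi_sum_def)
  have "u *\<^sub>R (z, b) + v *\<^sub>R (z', b') \<in> U" "u *\<^sub>R (z, d) + v *\<^sub>R (z', d') \<in> V"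
    using assms p q uv by (auto intro!: convexD simp del: scaleR_Pair add_Pair)
  then have "(u * z + v * z', (u * b + v * b') + (u * d + v * d')) \<in> epi_sum U V"
    by (intro epi_sumI) auto
  then show "u *\<^sub>R p + v *\<^sub>R q \<in> epi_sum U V"
    by (simp add: p q algebra_simps)
qed

lemma convex_epi_step:
  assumes "convex U" "convex Q"
  shows "convex (epi_step U Q)"
proof (rule convexI)
  fix p q and u v :: real
  assume "p \<in> epi_step U Q" "q \<in> epi_step U Q" and uv: "0 \<le> u" "0 \<le> v" "u + v = 1"
  then obtain y z a d y' z' a' d' where p: "p = (y, a + d)" "(z - y, a) \<in> U" "(z, d) \<in> Q"
    and q: "q = (y', a' + d')" "(z' - y', a') \<in> U" "(z', d') \<in> Q"
    by (auto simp: epi_step_def)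
  have "u *\<^sub>R (z - y, a) + v *\<^sub>R (z' - y', a') \<in> U" "u *\<^sub>R (z, d) + v *\<^sub>R (z', d') \<in> Q"
    using assms p q uv by (auto intro!: convexD simp del: scaleR_Pair add_Pair)
  then have "(u * y + v * y', (u * a + v * a') + (u * d + v * d')) \<in> epi_step U Q"
    by (intro epi_stepI[where z = "u * z + v * z'"]) (auto simp: algebra_simps)
  then show "u *\<^sub>R p + v *\<^sub>R q \<in> epi_step U Q"
    by (simp add: p q algebra_simps)
qed

lemma supports_epi_sum:
  assumes "supports U (z, b) p" "supports V (z, d) q"
  shows "supports (epi_sum U V) (z, b + d) (p + q)"
  using assms by (fastforce simp: supports_def epi_sum_def algebra_simps)

text \<open>The optimal move from \<open>y\<close> to \<open>z\<close> may be perturbed in either of its parts: keeping \<open>z\<close> while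
  \<open>y\<close> varies tests \<open>U\<close> with the opposite slope, and keeping the move \<open>z - y\<close> tests \<open>Q\<close>.\<close>

lemma supports_epi_step_iff:
  assumes "(z - y, a) \<in> U" "(z, d) \<in> Q"
  shows "supports (epi_step U Q) (y, a + d) m \<longleftrightarrow>
    supports U (z - y, a) (- m) \<and> supports Q (z, d) m"
proof
  assume m: "supports (epi_step U Q) (y, a + d) m"
  have "a - m * (x - (z - y)) \<le> c" if "(x, c) \<in> U" for x c
    using supportsD[OF m epi_stepI[of z "z - x" c, OF _ assms(2)]] that
    by (simp add: algebra_simps)
  moreover have "d + m * (w - z) \<le> e" if "(w, e) \<in> Q" for w e
    using supportsD[OF m epi_stepI[of w "w - (z - y)" a, OF _ that]] assms
    by (simp add: algebra_simps)
  ultimately show "supports U (z - y, a) (- m) \<and> supports Q (z, d) m"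
    by (auto simp: supports_def)
next
  assume "supports U (z - y, a) (- m) \<and> supports Q (z, d) m"
  then show "supports (epi_step U Q) (y, a + d) m"
    by (fastforce simp: supports_def epi_step_def algebra_simps)
qed

text \<open>Optimality of the move means that the sum of \<open>U\<close> and the translate of \<open>Q\<close> has a minimum there,
  so the sum rule for the slope \<open>0\<close> yields opposite slopes for the two.\<close>

lemma supports_epi_step_exists:
  assumes U: "convex U" "(z - y, a) \<in> U" "supports U (z - y, a) p"
    and Q: "convex Q" "(z, d) \<in> Q" "supports Q (z, d) q"
    and opt: "\<And>c. (y, c) \<in> epi_step U Q \<Longrightarrow> a + d \<le> c"
  shows "\<exists>m. supports (epi_step U Q) (y, a + d) m"
proof -
  let ?Q = "(\<lambda>w. w - (y, 0)) ` Q"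
  have mem: "(x, c) \<in> ?Q \<longleftrightarrow> (y + x, c) \<in> Q" for x c
    by (force simp: image_iff)
  have shift: "supports ?Q (z - y, d) r \<longleftrightarrow> supports Q (z, d) r" for r
    by (force simp: supports_def)
  have "convex ?Q"
    using convex_translation_subtract[OF Q(1)] by simp
  moreover have "a + d + 0 * (x - (z - y)) \<le> c + e" if "(x, c) \<in> U" "(x, e) \<in> ?Q" for x c e
    using opt[OF epi_stepI[of "y + x" y c U e Q]] that by (simp add: mem)
  ultimately obtain g where "supports U (z - y, a) g" "supports ?Q (z - y, d) (0 - g)"
    using supports_sum_split[OF U, of ?Q d q 0] Q
    by (metis (no_types, lifting) add.commute diff_add_cancel mem shift)
  then have "supports (epi_step U Q) (y, a + d) (- g)"
    using supports_epi_step_iff[OF U(2) Q(2)] by (simp add: shift)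
  then show ?thesis ..
qed

section \<open>The cost-to-go and the chain of subgradients\<close>

context
  fixes X Y :: "nat \<Rightarrow> real set" and C A :: "nat \<Rightarrow> real \<Rightarrow> real"
begin

text \<open>The arguments are the current time and the number of remaining periods. The cost at the
  current time is not included, so with no period left the cost-to-go is \<open>0\<close> at every level.\<close>

fun cost_to_go :: "nat \<Rightarrow> nat \<Rightarrow> (real \<times> real) set" where
  "cost_to_go t 0 = {(y, c). 0 \<le> c}"
| "cost_to_go t (Suc n) =
     epi_step (epigraph (X (Suc t)) (C (Suc t)))
       (epi_sum (epigraph (Y (Suc t)) (A (Suc t))) (cost_to_go (Suc t) n))"

definition path_cost :: "nat \<Rightarrow> nat \<Rightarrow> (nat \<Rightarrow> real) \<Rightarrow> real"
  where "path_cost t n s = (\<Sum>\<tau>\<in>{Suc t..t + n}. C \<tau> (rate s \<tau>) + A \<tau> (s \<tau>))"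

definition admissible :: "nat \<Rightarrow> nat \<Rightarrow> (nat \<Rightarrow> real) \<Rightarrow> bool"
  where "admissible t n s \<longleftrightarrow> (\<forall>\<tau>\<in>{Suc t..t + n}. rate s \<tau> \<in> X \<tau> \<and> s \<tau> \<in> Y \<tau>)"

lemma interval_Suc: "{Suc t..t + Suc n} = insert (Suc t) {Suc (Suc t)..Suc t + n}"
  by auto

lemma path_cost_Suc:
  "path_cost t (Suc n) s =
    C (Suc t) (s (Suc t) - s t) + (A (Suc t) (s (Suc t)) + path_cost (Suc t) n s)"
  unfolding path_cost_def interval_Suc by (simp add: rate_def)

lemma admissible_Suc:
  "admissible t (Suc n) s \<longleftrightarrow>
    s (Suc t) - s t \<in> X (Suc t) \<and> s (Suc t) \<in> Y (Suc t) \<and> admissible (Suc t) n s"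
  unfolding admissible_def interval_Suc by (simp add: rate_def)

lemma path_in_cost_to_go: "admissible t n s \<Longrightarrow> (s t, path_cost t n s) \<in> cost_to_go t n"
proof (induction n arbitrary: t)
  case 0
  then show ?case by (simp add: path_cost_def)
next
  case (Suc n)
  then show ?case
    unfolding path_cost_Suc cost_to_go.simps
    by (intro epi_stepI[where z = "s (Suc t)"] epi_sumI) (auto simp: epigraph_def admissible_Suc)
qed

lemma cost_to_go_path:
  "(y, c) \<in> cost_to_go t n \<Longrightarrow> \<exists>s. s t = y \<and> admissible t n s \<and> path_cost t n s \<le> c"
proof (induction n arbitrary: t y c)
  case 0
  then show ?case by (auto simp: path_cost_def admissible_def)
next
  case (Suc n)
  then obtain z a b d where c: "c = a + (b + d)" "z - y \<in> X (Suc t)" "C (Suc t) (z - y) \<le> a"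
    "z \<in> Y (Suc t)" "A (Suc t) z \<le> b" and "(z, d) \<in> cost_to_go (Suc t) n"
    by (auto simp: epi_step_def epi_sum_def epigraph_def)
  with Suc.IH obtain s where s: "s (Suc t) = z" "admissible (Suc t) n s"
    "path_cost (Suc t) n s \<le> d"
    by blast
  have agree: "rate (s(t := y)) \<tau> = rate s \<tau>" "(s(t := y)) \<tau> = s \<tau>"
    if "\<tau> \<in> {Suc (Suc t)..Suc t + n}" for \<tau>
    using that by (auto simp: rate_def)
  have "admissible (Suc t) n (s(t := y))"
    using s(2) agree unfolding admissible_def by simp
  moreover have "path_cost (Suc t) n (s(t := y)) = path_cost (Suc t) n s"
    using agree unfolding path_cost_def by (intro sum.cong) simp_all
  moreover have "(s(t := y)) t = y" "(s(t := y)) (Suc t) = z"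
    using s by simp_all
  ultimately show ?case
    using c s by (intro exI[of _ "s(t := y)"])
      (auto simp: admissible_Suc path_cost_Suc simp del: fun_upd_apply)
qed

lemma convex_cost_to_go:
  assumes "\<And>\<tau>. \<tau> \<in> {Suc t..t + n} \<Longrightarrow> convex_on (X \<tau>) (C \<tau>) \<and> convex_on (Y \<tau>) (A \<tau>)"
  shows "convex (cost_to_go t n)"
  using assms
proof (induction n arbitrary: t)
  case 0
  have "{(y, c). 0 \<le> c} = (UNIV :: real set) \<times> {0 :: real..}"
    by auto
  then show ?case
    by (simp add: convex_Times)
next
  case (Suc n)
  have "convex (cost_to_go (Suc t) n)"
    by (rule Suc.IH) (use Suc.prems in auto)
  then show ?case
    using Suc.prems[of "Suc t"]
    by (simp add: convex_epi_step convex_epi_sum convex_epigraph)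
qed

text \<open>The two parts carry each other through the induction: the sum rule, which splits a given
  slope of the cost-to-go between the next level cost and the remaining cost-to-go, presupposes that
  the latter has some supporting slope. The chain must be allowed to start from any supporting slope
  \<open>m\<close>, because the slope passed on by the splitting cannot be chosen.\<close>

lemma supporting_chain:
  assumes "\<And>\<tau>. \<tau> \<in> {Suc t..t + n} \<Longrightarrow> convex_on (X \<tau>) (C \<tau>) \<and> convex_on (Y \<tau>) (A \<tau>)"
    and "\<And>\<tau>. \<tau> \<in> {Suc t..t + n} \<Longrightarrow>
      subdifferentiable_on (X \<tau>) (C \<tau>) (rate s \<tau>) \<and> subdifferentiable_on (Y \<tau>) (A \<tau>) (s \<tau>)"
    and "admissible t n s"
    and "\<And>c. (s t, c) \<in> cost_to_go t n \<Longrightarrow> path_cost t n s \<le> c"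
  shows "(\<exists>m. supports (cost_to_go t n) (s t, path_cost t n s) m) \<and>
    (\<forall>m. supports (cost_to_go t n) (s t, path_cost t n s) m \<longrightarrow>
      (\<exists>g. g (Suc t) = - m \<and> g (Suc (t + n)) = 0 \<and>
        (\<forall>\<tau>\<in>{Suc t..t + n}. supports (epigraph (X \<tau>) (C \<tau>)) (rate s \<tau>, C \<tau> (rate s \<tau>)) (g \<tau>) \<and>
          supports (epigraph (Y \<tau>) (A \<tau>)) (s \<tau>, A \<tau> (s \<tau>)) (g (Suc \<tau>) - g \<tau>))))"
  using assms
proof (induction n arbitrary: t)
  case 0
  \<comment> \<open>The cost-to-go at the end is constant, so \<open>0\<close> is its only slope: the two values prescribed
    for \<open>g\<close> agree.\<close>
  have "supports {(y, c). 0 \<le> c} (s t, 0) 0"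
    by (auto simp: supports_def)
  moreover have "m = 0" if "supports {(y, c). 0 \<le> c} (s t, 0) m" for m
    using supportsD[OF that, of "s t + m" 0] zero_le_square[of m] by simp
  ultimately show ?case
    by (auto simp: path_cost_def)
next
  case (Suc n)
  let ?y = "s t" and ?z = "s (Suc t)"
  let ?U = "epigraph (X (Suc t)) (C (Suc t))" and ?W = "epigraph (Y (Suc t)) (A (Suc t))"
  let ?V = "cost_to_go (Suc t) n" and ?a = "C (Suc t) (?z - ?y)" and ?b = "A (Suc t) ?z"
  let ?d = "path_cost (Suc t) n s"
  have adm: "?z - ?y \<in> X (Suc t)" "?z \<in> Y (Suc t)" "admissible (Suc t) n s"
    using Suc.prems(3) by (simp_all add: admissible_Suc)
  have U: "convex ?U" "(?z - ?y, ?a) \<in> ?U" and W: "convex ?W" "(?z, ?b) \<in> ?W"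
    using Suc.prems(1)[of "Suc t"] adm
    by (simp_all add: convex_epigraph) (simp_all add: epigraph_def)
  have V: "convex ?V" "(?z, ?d) \<in> ?V"
    using Suc.prems(1) adm by (auto intro!: convex_cost_to_go path_in_cost_to_go)
  obtain p where p: "supports ?U (?z - ?y, ?a) p"
    using Suc.prems(2)[of "Suc t"]
    by (auto simp: subdifferentiable_on_def supports_epigraph_iff rate_def)
  obtain q where q: "supports ?W (?z, ?b) q"
    using Suc.prems(2)[of "Suc t"] by (auto simp: subdifferentiable_on_def supports_epigraph_iff)
  \<comment> \<open>Bellman's principle: a better tail, preceded by the same first move, would be a better path.\<close>
  have opt: "?d \<le> c" if "(?z, c) \<in> ?V" for c
  proof -
    have "(?y, ?a + (?b + c)) \<in> cost_to_go t (Suc n)"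
      unfolding cost_to_go.simps by (rule epi_stepI[OF U(2) epi_sumI[OF W(2) that]])
    from Suc.prems(4)[OF this] show ?thesis
      by (simp add: path_cost_Suc)
  qed
  note IH = Suc.IH[of "Suc t", OF _ _ adm(3) opt]
  from IH have IH_ex: "\<exists>m. supports ?V (?z, ?d) m"
    using Suc.prems(1,2) by simp
  from IH have IH_chain: "\<exists>g. g (Suc (Suc t)) = - m \<and> g (Suc (Suc t + n)) = 0 \<and>
        (\<forall>\<tau>\<in>{Suc (Suc t)..Suc t + n}.
          supports (epigraph (X \<tau>) (C \<tau>)) (rate s \<tau>, C \<tau> (rate s \<tau>)) (g \<tau>) \<and>
          supports (epigraph (Y \<tau>) (A \<tau>)) (s \<tau>, A \<tau> (s \<tau>)) (g (Suc \<tau>) - g \<tau>))"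
    if "supports ?V (?z, ?d) m" for m
    using Suc.prems(1,2) that by simp
  obtain v where v: "supports ?V (?z, ?d) v"
    using IH_ex by blast
  have Q: "convex (epi_sum ?W ?V)" "(?z, ?b + ?d) \<in> epi_sum ?W ?V"
    using W V by (auto intro: convex_epi_sum epi_sumI)
  have "\<exists>m. supports (cost_to_go t (Suc n)) (?y, path_cost t (Suc n) s) m"
    using supports_epi_step_exists[OF U p Q supports_epi_sum[OF q v]] Suc.prems(4)
    by (simp add: path_cost_Suc)
  moreover have "\<exists>g. g (Suc t) = - m \<and> g (Suc (t + Suc n)) = 0 \<and>
        (\<forall>\<tau>\<in>{Suc t..t + Suc n}. supports (epigraph (X \<tau>) (C \<tau>)) (rate s \<tau>, C \<tau> (rate s \<tau>)) (g \<tau>) \<and>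
          supports (epigraph (Y \<tau>) (A \<tau>)) (s \<tau>, A \<tau> (s \<tau>)) (g (Suc \<tau>) - g \<tau>))"
    if "supports (cost_to_go t (Suc n)) (?y, path_cost t (Suc n) s) m" for m
  proof -
    have mU: "supports ?U (?z - ?y, ?a) (- m)"
      and mQ: "supports (epi_sum ?W ?V) (?z, ?b + ?d) m"
      using that supports_epi_step_iff[OF U(2) Q(2)] by (simp_all add: path_cost_Suc)
    obtain k where k: "supports ?W (?z, ?b) k" "supports ?V (?z, ?d) (m - k)"
      using supports_sum_split[OF W q V v, of m] supportsD[OF mQ epi_sumI] by blast
    obtain g where g: "g (Suc (Suc t)) = - (m - k)" "g (Suc (Suc t + n)) = 0"
        "\<And>\<tau>. \<tau> \<in> {Suc (Suc t)..Suc t + n} \<Longrightarrow>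
          supports (epigraph (X \<tau>) (C \<tau>)) (rate s \<tau>, C \<tau> (rate s \<tau>)) (g \<tau>) \<and>
          supports (epigraph (Y \<tau>) (A \<tau>)) (s \<tau>, A \<tau> (s \<tau>)) (g (Suc \<tau>) - g \<tau>)"
      using IH_chain[OF k(2)] by blast
    show ?thesis
      unfolding interval_Suc
      using g mU k(1) by (intro exI[of _ "g(Suc t := - m)"]) (auto simp: rate_def)
  qed
  ultimately show ?case by blast
qed

end

section \<open>Multipliers for the capacity constraints\<close>

lemma convex_on_UNIV_subdifferentiable:
  assumes "convex_on UNIV f"
  shows "subdifferentiable_on UNIV f x"
  using convex_le_Inf_differential[OF assms] unfolding subdifferentiable_on_def by auto

text \<open>On the interval, \<open>f\<close> is the sum of \<open>f\<close> on the whole line and the function that is \<open>0\<close> on the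
  interval and \<open>\<infinity>\<close> outside it. The sum rule splits \<open>k\<close> into a subgradient of \<open>f\<close> and a normal to the
  interval; \<open>l\<close> is the negative of that normal.\<close>

lemma interval_multiplier:
  assumes A: "convex_on UNIV f" and x: "x \<in> {0..e}"
    and k: "supports (epigraph {0..e} f) (x, f x) k"
  shows "\<exists>l. (\<forall>y. f y \<ge> f x + (k + l) * (y - x)) \<and> (\<forall>y\<in>{0..e}. 0 \<le> l * (y - x))"
proof -
  let ?V = "epigraph UNIV f" and ?U = "epigraph {0..e} (\<lambda>_. 0 :: real)"
  have V: "convex ?V" "(x, f x) \<in> ?V" and U: "convex ?U" "(x, 0) \<in> ?U"
    using A x by (auto simp: convex_epigraph convex_on_const) (auto simp: epigraph_def)
  obtain p where p: "supports ?V (x, f x) p"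
    using convex_on_UNIV_subdifferentiable[OF A]
    by (auto simp: subdifferentiable_on_def supports_epigraph_iff)
  have 0: "supports ?U (x, 0) 0"
    by (auto simp: supports_def epigraph_def)
  have "f x + 0 + k * (y - x) \<le> c + d" if "(y, c) \<in> ?V" "(y, d) \<in> ?U" for y c d
    using supportsD[OF k, of y c] that by (simp add: epigraph_def)
  from supports_sum_split[OF V p U 0 this]
  obtain h where "supports ?V (x, f x) h" "supports ?U (x, 0) (k - h)"
    by blast
  then show ?thesis
    using supports_epigraph_iff[of UNIV f x h]
      supports_epigraph_iff[of "{0..e}" "\<lambda>_. 0" x "k - h"]
    by (intro exI[of _ "h - k"]) (auto simp: algebra_simps)
qed

lemma sum_by_parts_chain:
  fixes g v :: "nat \<Rightarrow> real"
  assumes "v 0 = 0"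
  shows "(\<Sum>t=1..T. g t * (v t - v (t - 1)) + (g (Suc t) - g t) * v t) = g (Suc T) * v T"
  using assms by (induction T) (auto simp: algebra_simps)

text \<open>Complementary slackness is the statement that \<open>- l t\<close> lies in the normal cone of the capacity
  interval at \<open>s t\<close>, which is the form in which both directions use it.\<close>

lemma compl_slack_iff:
  assumes "\<And>t. t \<in> {1..T} \<Longrightarrow> E t > 0"
    and "\<And>t. t \<in> {1..T} \<Longrightarrow> s t \<in> {0..E t}"
  shows "compl_slack T E s l \<longleftrightarrow> (\<forall>t\<in>{1..T}. \<forall>y\<in>{0..E t}. 0 \<le> l t * (y - s t))"
proof -
  have "((0 < s t \<and> s t < E t \<longrightarrow> l t = 0) \<and> (s t = 0 \<longrightarrow> l t \<ge> 0) \<and> (s t = E t \<longrightarrow> l t \<le> 0))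
    \<longleftrightarrow> (\<forall>y\<in>{0..E t}. 0 \<le> l t * (y - s t))" (is "?L \<longleftrightarrow> ?R") if "t \<in> {1..T}" for t
  proof
    assume ?L
    with assms(2)[OF that] show ?R
      by (cases "s t = 0"; cases "s t = E t") (auto intro: mult_nonneg_nonneg mult_nonpos_nonpos)
  next
    assume ?R
    then have "0 \<le> l t * (0 - s t)" "0 \<le> l t * (E t - s t)"
      using assms(1)[OF that] by (auto dest: bspec[of _ _ 0])
    then show ?L
      using assms(1)[OF that] by (auto simp: zero_le_mult_iff mult_le_0_iff)
  qed
  then show ?thesis
    unfolding compl_slack_def by blast
qed

section \<open>Strong and weak duality\<close>

lemma multipliers_exist:
  assumes E: "\<And>t. t \<in> {1..T} \<Longrightarrow> E t > 0"
    and C: "\<And>t. t \<in> {1..T} \<Longrightarrow> convex_on (rate_set P\<^sub>I P\<^sub>O t) (C t)"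
    and A: "\<And>t. t \<in> {1..T} \<Longrightarrow> convex_on UNIV (A t)"
    and s: "solves_P T E P\<^sub>I P\<^sub>O C A s0 s"
    and sub: "\<And>t. t \<in> {1..T} \<Longrightarrow> subdifferentiable_on (rate_set P\<^sub>I P\<^sub>O t) (C t) (rate s t)"
  shows "\<exists>l. minimises_lagrangian T P\<^sub>I P\<^sub>O C A s0 s l \<and> compl_slack T E s l"
proof -
  let ?X = "rate_set P\<^sub>I P\<^sub>O" and ?Y = "\<lambda>t. {0..E t}"
  have feasible_iff: "feasible T E P\<^sub>I P\<^sub>O s0 r \<longleftrightarrow> r 0 = s0 \<and> admissible ?X ?Y 0 T r" for r
    by (auto simp: feasible_def rate_feasible_def admissible_def)
  have cost: "total_cost T C A r = path_cost C A 0 T r" for r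
    by (simp add: total_cost_def path_cost_def)
  from s have s0: "s 0 = s0" and adm: "admissible ?X ?Y 0 T s"
    and opt: "\<And>r. r 0 = s0 \<Longrightarrow> admissible ?X ?Y 0 T r \<Longrightarrow> path_cost C A 0 T s \<le> path_cost C A 0 T r"
    by (auto simp: solves_P_def is_arg_min_def feasible_iff cost not_less)
  have sY: "s t \<in> ?Y t" if "t \<in> {1..T}" for t
    using adm that by (auto simp: admissible_def)
  have "subdifferentiable_on (?Y t) (A t) (s t)" if "t \<in> {1..T}" for t
    using convex_on_UNIV_subdifferentiable[OF A[OF that], of "s t"]
    unfolding subdifferentiable_on_def by blast
  moreover have "convex_on (?Y t) (A t)" if "t \<in> {1..T}" for t
    using convex_on_subset[OF A[OF that]] by simp
  moreover have "path_cost C A 0 T s \<le> c" if c: "(s 0, c) \<in> cost_to_go ?X ?Y C A 0 T" for c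
    using cost_to_go_path[OF c] opt s0 by force
  ultimately obtain g where gT: "g (Suc T) = 0"
    and g: "\<And>t. t \<in> {1..T} \<Longrightarrow>
        supports (epigraph (?X t) (C t)) (rate s t, C t (rate s t)) (g t) \<and>
        supports (epigraph (?Y t) (A t)) (s t, A t (s t)) (g (Suc t) - g t)"
    using supporting_chain[of 0 T ?X C ?Y A s] C sub adm by force
  have "\<exists>l. (\<forall>y. A t y \<ge> A t (s t) + (g (Suc t) - g t + l) * (y - s t)) \<and>
      (\<forall>y\<in>{0..E t}. 0 \<le> l * (y - s t))" if "t \<in> {1..T}" for t
    using interval_multiplier[OF A sY] g that by blast
  then obtain l where
    l: "\<And>t y. t \<in> {1..T} \<Longrightarrow> A t y \<ge> A t (s t) + (g (Suc t) - g t + l t) * (y - s t)"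
    and l_cone: "\<And>t y. t \<in> {1..T} \<Longrightarrow> y \<in> {0..E t} \<Longrightarrow> 0 \<le> l t * (y - s t)"
    by metis
  have "compl_slack T E s l"
    using compl_slack_iff[of T E s l, OF E sY] l_cone by blast
  moreover have "lagrangian T C A l s \<le> lagrangian T C A l r"
    if r: "rate_feasible T P\<^sub>I P\<^sub>O s0 r" for r
  proof -
    define v where "v t = r t - s t" for t
    \<comment> \<open>The subgradient inequalities of one period; the multiplier absorbs the part of the slope
      that is normal to the capacity interval.\<close>
    have period: "(C t (rate s t) + A t (s t) - l t * s t) +
        (g t * (v t - v (t - 1)) + (g (Suc t) - g t) * v t)
        \<le> C t (rate r t) + A t (r t) - l t * r t" if t: "t \<in> {1..T}" for t
    proof -
      have "rate r t \<in> ?X t"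
        using r t by (simp add: rate_feasible_def)
      then have "C t (rate s t) + g t * (rate r t - rate s t) \<le> C t (rate r t)"
        using g[OF t] by (simp add: supports_epigraph_iff)
      moreover have "rate r t - rate s t = v t - v (t - 1)"
        by (simp add: rate_def v_def)
      ultimately show ?thesis
        using l[OF t, of "r t"] by (simp add: v_def algebra_simps)
    qed
    have "v 0 = 0"
      using r s0 by (simp add: v_def rate_feasible_def)
    then have "lagrangian T C A l s = lagrangian T C A l s +
        (\<Sum>t=1..T. g t * (v t - v (t - 1)) + (g (Suc t) - g t) * v t)"
      using sum_by_parts_chain[of v g T] gT by simp
    also have "\<dots> \<le> lagrangian T C A l r"
      unfolding lagrangian_def sum.distrib[symmetric] by (intro sum_mono period)
    finally show ?thesis .
  qed
  ultimately show ?thesis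
    unfolding minimises_lagrangian_def by blast
qed

lemma multipliers_sufficient:
  assumes E: "\<And>t. t \<in> {1..T} \<Longrightarrow> E t > 0"
    and min: "minimises_lagrangian T P\<^sub>I P\<^sub>O C A s0 s l"
    and slack: "compl_slack T E s l"
    and feas: "feasible T E P\<^sub>I P\<^sub>O s0 s"
  shows "solves_P T E P\<^sub>I P\<^sub>O C A s0 s"
proof -
  have L: "lagrangian T C A l r = total_cost T C A r - (\<Sum>t=1..T. l t * r t)" for r
    by (simp add: lagrangian_def total_cost_def sum_subtractf)
  have "total_cost T C A s \<le> total_cost T C A r" if r: "feasible T E P\<^sub>I P\<^sub>O s0 r" for r
  proof -
    have "0 \<le> l t * (r t - s t)" if "t \<in> {1..T}" for t
      using compl_slack_iff[of T E s l, OF E] slack feas r that by (auto simp: feasible_def)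
    then have "(\<Sum>t=1..T. l t * s t) \<le> (\<Sum>t=1..T. l t * r t)"
      by (intro sum_mono) (auto simp: algebra_simps)
    moreover have "lagrangian T C A l s \<le> lagrangian T C A l r"
      using min r by (auto simp: minimises_lagrangian_def feasible_def)
    ultimately show ?thesis
      by (simp add: L)
  qed
  then show ?thesis
    using feas by (force simp: solves_P_def is_arg_min_def)
qed

theorem theorem5:
  fixes T :: nat
    and E P\<^sub>I P\<^sub>O :: "nat \<Rightarrow> real"
    and C A :: "nat \<Rightarrow> real \<Rightarrow> real"
    and s0 :: real
  assumes "T \<ge> 1"
    and "\<And>t. t \<in> {1..T} \<Longrightarrow> E t > 0"
    and "\<And>t. t \<in> {1..T} \<Longrightarrow> P\<^sub>I t \<ge> 0"
    and "\<And>t. t \<in> {1..T} \<Longrightarrow> P\<^sub>O t \<ge> 0"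
    and "\<And>t. t \<in> {1..T} \<Longrightarrow> convex_on (rate_set P\<^sub>I P\<^sub>O t) (C t)"
    and "\<And>t. t \<in> {1..T} \<Longrightarrow> convex_on UNIV (A t)"
  shows "(\<forall>s. solves_P T E P\<^sub>I P\<^sub>O C A s0 s \<longrightarrow>
        (\<forall>t\<in>{1..T}. subdifferentiable_on (rate_set P\<^sub>I P\<^sub>O t) (C t) (rate s t)) \<longrightarrow>
        (\<exists>l. minimises_lagrangian T P\<^sub>I P\<^sub>O C A s0 s l \<and> compl_slack T E s l)) \<and>
    (\<forall>s l. s 0 = s0 \<longrightarrow> minimises_lagrangian T P\<^sub>I P\<^sub>O C A s0 s l \<longrightarrow> compl_slack T E s l \<longrightarrow>
        feasible T E P\<^sub>I P\<^sub>O s0 s \<longrightarrow> solves_P T E P\<^sub>I P\<^sub>O C A s0 s)"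
proof (intro conjI allI impI)
  fix s
  assume "solves_P T E P\<^sub>I P\<^sub>O C A s0 s"
    and "\<forall>t\<in>{1..T}. subdifferentiable_on (rate_set P\<^sub>I P\<^sub>O t) (C t) (rate s t)"
  then show "\<exists>l. minimises_lagrangian T P\<^sub>I P\<^sub>O C A s0 s l \<and> compl_slack T E s l"
    by (intro multipliers_exist assms(2,5,6)) auto
next
  fix s l
  assume "minimises_lagrangian T P\<^sub>I P\<^sub>O C A s0 s l" "compl_slack T E s l"
    "feasible T E P\<^sub>I P\<^sub>O s0 s"
  then show "solves_P T E P\<^sub>I P\<^sub>O C A s0 s"
    by (intro multipliers_sufficient[OF assms(2)])
qed

end
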